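(* Let $(g(x),f(x))$ be a Riordan array over $R$, that is, $g\in\mathcal{F}_0$ and $f\in\mathcal{F}_1$. For all integers $n,k\ge 0$, the $(n,k)$-th term $\hat{t}_{n,k}$ of the inversion $(g(x),f(x))^!$ of the Riordan array $(g(x),f(x))$ is given by $$\hat{t}_{n,k}=\frac{(-1)^k}{n+1}\binom{n+1}{k}\,[x^n]\,f(x)^k\left(\frac{1}{g(x)}\right)^{n+1}.$$
   Context: $R$ is a field of characteristic zero (for concreteness $R=\mathbb{Q}$). $\mathcal{F}_0$ is the set of formal power series $a_0+a_1x+a_2x^2+\cdots\in R[[x]]$ with $a_0\neq 0$, and $\mathcal{F}_1$ is the set of formal power series $a_1x+a_2x^2+\cdots\in R[[x]]$ with $a_1\ne 0$. $[x^n]$ denotes extraction of the coefficient of $x^n$. A Riordan array $(g(x),f(x))$ with $g\in\mathcal{F}_0$, $f\in\mathcal{F}_1$ is the lower-triangular matrix $(t_{n,k})_{n,k\ge0}$ with $t_{n,k}=[x^n]g(x)f(x)^k$. Its bivariate generating function is $G(x,y)=\sum_{n,k\ge 0}t_{n,k}x^ny^k=\frac{g(x)}{1-yf(x)}\in R[y][[x]]$. The inversion $(g(x),f(x))^!$ is the array $(\hat{t}_{n,k})_{n,k\ge0}$ defined by $\sum_{n,k\ge0}\hat{t}_{n,k}x^ny^k=\frac1x\operatorname{Rev}_x\bigl(xG(x,y)\bigr)$, where $\operatorname{Rev}_x$ denotes the compositional inverse in the variable $x$ (with $y$ fixed): $U(x,y)=\operatorname{Rev}_x(xG(x,y))$ is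 the unique series in $R[y][[x]]$ with $U(0,y)=0$ and $U(x,y)\,G(U(x,y),y)=x$. *)

theory Defs
  imports "HOL-Computational_Algebra.Computational_Algebra"
begin

unbundle fps_syntax

definition riordan_array :: "'a::field_char_0 fps \<Rightarrow> 'a fps \<Rightarrow> nat \<Rightarrow> nat \<Rightarrow> 'a" where
  "riordan_array g f n k = (g * f ^ k) $ n"

text \<open>
  The ring \<open>R[y][[x]]\<close> is rendered as the type \<open>'a poly fps\<close>: the polynomial variable is \<open>y\<close>
  and the power series variable is \<open>x\<close>. The sum over \<open>k\<close> may stop at \<open>n\<close> because the
  definition is only meant for lower-triangular arrays; the lemmas \<open>riordan_array_lower_triangular\<close>
  and \<open>array_gf_riordan_array\<close> below justify this for Riordan arrays.
\<close>

definition array_gf :: "(nat \<Rightarrow> nat \<Rightarrow> 'a::field_char_0) \<Rightarrow> 'a poly fps" where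
  "array_gf t = Abs_fps (\<lambda>n. \<Sum>k\<le>n. monom (t n k) k)"

text \<open>
  The library's \<open>fps_inv\<close> requires coefficients in a field, which \<open>'a poly\<close> is not. The lemma
  \<open>ex1_fps_compose_eq_X\<close> below shows that the definite description denotes whenever the
  linear coefficient is a unit.
\<close>

definition fps_rev :: "'a::idom fps \<Rightarrow> 'a fps" where
  "fps_rev F = (THE U. U $ 0 = 0 \<and> F oo U = fps_X)"

definition array_inversion :: "(nat \<Rightarrow> nat \<Rightarrow> 'a::field_char_0) \<Rightarrow> nat \<Rightarrow> nat \<Rightarrow> 'a" where
  "array_inversion t n k = coeff (fps_shift 1 (fps_rev (fps_X * array_gf t)) $ n) k"

lemma riordan_array_lower_triangular:
  assumes "f $ 0 = 0" and "n < k"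
  shows "riordan_array g f n k = 0"
  using startsby_zero_power_prefix[OF assms(1), of k] assms(2)
  by (auto simp: riordan_array_def fps_mult_nth intro!: sum.neutral)

lemma coeff_array_gf_riordan_array:
  assumes "f $ 0 = 0"
  shows "coeff (array_gf (riordan_array g f) $ n) k = riordan_array g f n k"
  using riordan_array_lower_triangular[OF assms, of n k g]
  by (auto simp: array_gf_def coeff_sum)

lemma array_gf_riordan_array:
  fixes f g :: "'a::field_char_0 fps"
  assumes "f $ 0 = 0"
  shows "array_gf (riordan_array g f) * (1 - fps_const [:0, 1:] * Abs_fps (\<lambda>n. [:f $ n:]))
           = Abs_fps (\<lambda>n. [:g $ n:])"
proof -
  let ?G = "array_gf (riordan_array g f)"
  let ?f = "Abs_fps (\<lambda>n. [:f $ n:])"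
  have "coeff ((?G * (1 - fps_const [:0, 1:] * ?f)) $ n) k = coeff [:g $ n:] k" for n k
  proof -
    have "?G * (1 - fps_const [:0, 1:] * ?f) = ?G - fps_const [:0, 1:] * (?G * ?f)"
      by (simp add: algebra_simps)
    then have *: "coeff ((?G * (1 - fps_const [:0, 1:] * ?f)) $ n) k =
        riordan_array g f n k - coeff (pCons 0 ((?G * ?f) $ n)) k"
      by (simp add: coeff_array_gf_riordan_array[OF assms])
    show ?thesis
    proof (cases k)
      case 0
      then show ?thesis using * by (simp add: riordan_array_def)
    next
      case (Suc j)
      have "coeff ((?G * ?f) $ n) j = (g * f ^ j * f) $ n"
        by (simp add: fps_mult_nth[of ?G] fps_mult_nth[of "g * f ^ j"] coeff_sum
            mult.commute[of "f $ _"] coeff_array_gf_riordan_array[OF assms] riordan_array_def)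
      then show ?thesis using * Suc by (simp add: riordan_array_def mult_ac)
    qed
  qed
  then show ?thesis by (simp add: fps_eq_iff poly_eq_iff)
qed

lemma ex_fps_left_compinv:
  fixes F :: "'a::idom fps"
  assumes F0: "F $ 0 = 0" and F1: "F $ 1 dvd 1"
  shows "\<exists>V. V $ 0 = 0 \<and> V $ 1 dvd 1 \<and> V oo F = fps_X"
proof -
  obtain c where c: "F $ 1 * c = 1" using F1 by (metis dvdE)
  define H where
    "H v n = c ^ n * (fps_X $ n - (\<Sum>i<n. v i * F ^ i $ n))" for v :: "nat \<Rightarrow> 'a" and n
  define v where "v = wfrec less_than H"
  have v: "v n = H v n" for n
    unfolding v_def by (subst wfrec[OF wf_less_than]) (simp add: H_def cut_apply)
  have "(Abs_fps v oo F) $ n = fps_X $ n" for n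
  proof -
    have "v n * F ^ n $ n = (F $ 1 * c) ^ n * (fps_X $ n - (\<Sum>i<n. v i * F ^ i $ n))"
      by (simp add: v[of n] H_def startsby_zero_power_nth_same[OF F0] power_mult_distrib mult_ac)
    also have "\<dots> = fps_X $ n - (\<Sum>i<n. v i * F ^ i $ n)" using c by simp
    finally show ?thesis
      by (simp add: fps_compose_nth atLeast0AtMost flip: lessThan_Suc_atMost)
  qed
  then have "Abs_fps v oo F = fps_X" by (simp add: fps_eq_iff)
  moreover have v0: "v 0 = 0" by (subst v) (simp add: H_def)
  moreover have "v 1 = c" by (subst v) (simp add: H_def v0)
  ultimately show ?thesis using c by
    (intro exI[of _ "Abs_fps v"]) (auto intro: dvdI[of _ _ "F $ 1"] simp: mult.commute)
qed

lemma ex1_fps_compose_eq_X: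
  fixes F :: "'a::idom fps"
  assumes F0: "F $ 0 = 0" and F1: "F $ 1 dvd 1"
  shows "\<exists>!U. U $ 0 = 0 \<and> F oo U = fps_X"
proof -
  obtain V where V: "V $ 0 = 0" "V $ 1 dvd 1" "V oo F = fps_X"
    using ex_fps_left_compinv[OF F0 F1] by blast
  obtain W where W: "W $ 0 = 0" "W oo V = fps_X"
    using ex_fps_left_compinv[OF V(1,2)] by blast
  have "F = W oo (V oo F)"
    using fps_compose_assoc[OF F0 V(1), of W] W F0 by simp
  then have "F oo V = fps_X" using V W by simp
  moreover have "U = V" if U: "U $ 0 = 0" "F oo U = fps_X" for U
    using fps_compose_assoc[OF U(1) F0, of V] U V by simp
  ultimately show ?thesis using V by blast
qed

lemma fps_rev_riordan_array:
  fixes f g :: "'a::field_char_0 fps"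
  assumes "g $ 0 \<noteq> 0" and "f $ 0 = 0"
  defines "G \<equiv> array_gf (riordan_array g f)"
  shows "fps_rev (fps_X * G) $ 0 = 0"
    and "fps_rev (fps_X * G) * (G oo fps_rev (fps_X * G)) = fps_X"
proof -
  have "(fps_X * G) $ 1 = [:g $ 0:]"
    by (simp add: G_def array_gf_def riordan_array_def monom_0)
  then have "(fps_X * G) $ 1 dvd 1"
    using assms(1) by (simp add: is_unit_triv)
  then have *: "fps_rev (fps_X * G) $ 0 = 0 \<and> fps_X * G oo fps_rev (fps_X * G) = fps_X"
    unfolding fps_rev_def by (rule theI'[OF ex1_fps_compose_eq_X[rotated]]) simp
  then show "fps_rev (fps_X * G) $ 0 = 0" by simp
  show "fps_rev (fps_X * G) * (G oo fps_rev (fps_X * G)) = fps_X"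
    using * by (metis fps_compose_mult_distrib fps_X_fps_compose_startby0)
qed

end

theory Submission
  imports Defs
begin

text \<open>
  The proof is Lagrange inversion over \<open>R[y]\<close>: with \<open>G = g / (1 - y f)\<close> and \<open>U = Rev (x G)\<close>,
  \<open>(n + 1) [x^(n+1)] U = [x^n] (1 / G)^(n+1) = [x^n] ((1 - y f) / g)^(n+1)\<close>, and the binomial
  theorem gives the coefficient of \<open>y^k\<close>. Residues are not available over \<open>R[y]\<close>, so Lagrange
  inversion is derived without Laurent series: differentiating \<open>U(F) = x\<close> for \<open>F = x G\<close> and
  multiplying by \<open>P^(n+1)\<close>, where \<open>P = 1 / G\<close>, gives
  \<open>[x^n] P^(n+1) = (\<Sum>i\<le>n. (i + 1) u_(i+1) [x^(n-i)] P^(n-i+1) F')\<close>,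
  whose terms vanish except for \<open>i = n\<close>.
\<close>

text \<open>This replaces the fact that F' / F^(m+1), with F = x G, has residue 0 for m > 0. Since P
  G = 1 gives P G' = - P' G, the product is P^m - x P^(m-1) P', that is P^m - x (P^m)' / m.\<close>

lemma fps_nth_power_mult_deriv_fps_X_mult:
  fixes G P :: "'a::{idom,ring_char_0} fps"
  assumes "P * G = 1"
  shows "(P ^ (m + 1) * fps_deriv (fps_X * G)) $ m = (if m = 0 then 1 else 0)"
proof (cases m)
  case 0
  then show ?thesis using arg_cong[OF assms, of "\<lambda>h. h $ 0"] by simp
next
  case (Suc j)
  have PG': "P * fps_deriv G = - (fps_deriv P * G)"
    using arg_cong[OF assms, of fps_deriv] by (simp add: eq_neg_iff_add_eq_0)
  have "P ^ (m + 1) * fps_deriv (fps_X * G) =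
      P ^ m * (P * G) + fps_X * P ^ m * (P * fps_deriv G)"
    by (simp add: algebra_simps)
  also have "\<dots> = P ^ m * (P * G) - fps_X * P ^ j * fps_deriv P * (P * G)"
    unfolding PG' by (simp add: Suc algebra_simps)
  also have "\<dots> = P ^ m - fps_X * (P ^ j * fps_deriv P)"
    by (simp add: assms mult.assoc)
  finally have eq: "P ^ (m + 1) * fps_deriv (fps_X * G) = P ^ m - fps_X * (P ^ j * fps_deriv P)" .
  have "of_nat m * (fps_X * (P ^ j * fps_deriv P)) = fps_X * fps_deriv (P ^ m)"
    by (simp add: Suc fps_deriv_power' mult_ac del: power_Suc of_nat_Suc)
  \<comment> \<open>The operator x d/dx multiplies the coefficient of x^m by m, and m can be
    cancelled in characteristic zero.\<close>
  then have "of_nat m * (fps_X * (P ^ j * fps_deriv P)) $ m = of_nat m * P ^ m $ m"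
    by (metis Suc fps_X_mult_nth fps_deriv_nth fps_mult_left_const_nth fps_of_nat diff_Suc_1
        nat.distinct(1) Suc_eq_plus1)
  then have "(fps_X * (P ^ j * fps_deriv P)) $ m = P ^ m $ m"
    using Suc by (simp del: of_nat_Suc power_Suc)
  then show ?thesis unfolding eq using Suc by simp
qed

lemma lagrange_inversion:
  fixes G P U :: "'a::{idom,ring_char_0} fps"
  assumes PG: "P * G = 1" and UF: "U oo (fps_X * G) = fps_X"
  shows "of_nat (n + 1) * U $ (n + 1) = P ^ (n + 1) $ n"
proof -
  let ?F = "fps_X * G" and ?U' = "fps_deriv U"
  define D where "D = P ^ (n + 1) * fps_deriv ?F"
  have deriv1: "(?U' oo ?F) * fps_deriv ?F = 1"
    using arg_cong[OF UF, of fps_deriv] fps_compose_deriv[of ?F U] by simp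
  have term1: "(D * ?F ^ i) $ n = (if i = n then 1 else 0)" if "i \<le> n" for i
  proof -
    have "P ^ (n + 1) = P ^ (n - i + 1) * P ^ i"
      using that by (simp flip: power_add)
    \<comment> \<open>The factor P^i cancels the G^i in F^i = x^i G^i, so only a shift by i
      remains.\<close>
    then have "D * ?F ^ i = fps_X ^ i * (P ^ (n - i + 1) * fps_deriv ?F) * (P * G) ^ i"
      unfolding D_def by (simp only: power_mult_distrib mult_ac)
    then have "D * ?F ^ i = fps_X ^ i * (P ^ (n - i + 1) * fps_deriv ?F)"
      unfolding PG by simp
    then have "(D * ?F ^ i) $ n = (P ^ (n - i + 1) * fps_deriv ?F) $ (n - i)"
      using that by (simp add: fps_X_power_mult_nth)
    then show ?thesis
      using that fps_nth_power_mult_deriv_fps_X_mult[OF PG, of "n - i"] by auto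
  qed
  have "P ^ (n + 1) $ n = (D * (?U' oo ?F)) $ n"
    using deriv1 by (simp add: D_def mult_ac)
  also have "\<dots> = (\<Sum>j\<le>n. \<Sum>i\<le>n - j. D $ j * (?U' $ i * ?F ^ i $ (n - j)))"
    by (simp add: fps_mult_nth fps_compose_nth sum_distrib_left atLeast0AtMost)
  \<comment> \<open>F^i starts at x^i, so the terms added with i > n - j vanish; with independent
    ranges the sums can be swapped.\<close>
  also have "\<dots> = (\<Sum>j\<le>n. \<Sum>i\<le>n. D $ j * (?U' $ i * ?F ^ i $ (n - j)))"
    by (intro sum.cong sum.mono_neutral_left) (auto simp: startsby_zero_power_prefix)
  also have "\<dots> = (\<Sum>i\<le>n. ?U' $ i * (D * ?F ^ i) $ n)"
    by (subst sum.swap) (simp add: fps_mult_nth sum_distrib_left atLeast0AtMost mult_ac)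
  also have "\<dots> = (\<Sum>i\<le>n. if i = n then ?U' $ i else 0)"
    by (intro sum.cong) (auto simp: term1)
  also have "\<dots> = of_nat (n + 1) * U $ (n + 1)"
    by simp
  finally show ?thesis ..
qed

text \<open>\<open>fps_rev\<close> is specified as a right inverse, but
  \<open>lagrange_inversion\<close> needs a left one. Any left inverse V equals it: V = V o (F o U)
  = (V o F) o U = U.\<close>

lemma fps_rev_compose:
  fixes F :: "'a::idom fps"
  assumes F0: "F $ 0 = 0" and F1: "F $ 1 dvd 1"
  shows "fps_rev F oo F = fps_X"
proof -
  obtain V where V: "V $ 0 = 0" "V oo F = fps_X"
    using ex_fps_left_compinv[OF F0 F1] by blast
  have U: "fps_rev F $ 0 = 0" "F oo fps_rev F = fps_X"
    using theI'[OF ex1_fps_compose_eq_X[OF F0 F1]] by (simp_all add: fps_rev_def)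
  have "fps_rev F = V"
    using fps_compose_assoc[OF U(1) F0, of V] U V by simp
  then show ?thesis using V by simp
qed

definition fps_lift :: "'a::comm_ring_1 fps \<Rightarrow> 'a poly fps" where
  "fps_lift f = Abs_fps (\<lambda>n. [:f $ n:])"

lemma fps_lift_nth [simp]: "fps_lift f $ n = [:f $ n:]"
  by (simp add: fps_lift_def)

lemma fps_lift_1 [simp]: "fps_lift 1 = 1"
  by (simp add: fps_eq_iff one_pCons)

lemma fps_lift_mult: "fps_lift (f * g) = fps_lift f * fps_lift g"
  by (rule fps_ext, rule poly_eqI) (simp add: fps_mult_nth coeff_sum coeff_pCons mult.commute split: nat.splits)

lemma fps_lift_power: "fps_lift (f ^ n) = fps_lift f ^ n"
  by (induction n) (simp_all add: fps_lift_mult)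

lemma coeff_power_one_minus_y_mult:
  fixes f h :: "'a::comm_ring_1 fps"
  shows "coeff (((1 - fps_const [:0, 1:] * fps_lift f) * fps_lift h) ^ N $ n) k =
    (-1) ^ k * of_nat (N choose k) * (f ^ k * h ^ N) $ n"
proof -
  have "1 - fps_const [:0, 1:] * fps_lift f = fps_const [:0, -1:] * fps_lift f + 1"
    by (rule fps_ext) simp
  then have "((1 - fps_const [:0, 1:] * fps_lift f) * fps_lift h) ^ N =
      (fps_const [:0, -1:] * fps_lift f + 1) ^ N * fps_lift (h ^ N)"
    by (simp only: power_mult_distrib fps_lift_power)
  also have "\<dots> = (\<Sum>j\<le>N. of_nat (N choose j) * fps_const ([:0, -1:] ^ j) * fps_lift (f ^ j * h ^ N))"
    by (simp add: binomial_ring sum_distrib_left power_mult_distrib fps_lift_power fps_lift_mult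
        fps_const_power mult_ac)
  also have "coeff (\<dots> $ n) k =
      (\<Sum>j\<le>N. if j = k then (-1) ^ k * of_nat (N choose k) * (f ^ k * h ^ N) $ n else 0)"
  proof -
    \<comment> \<open>Each power of -y is a monomial, so only the summand j = k reaches y^k.\<close>
    have "[:0, -1:] ^ j = monom ((-1) ^ j :: 'a) j" for j
      by (induction j) (simp_all add: monom_0 monom_Suc smult_monom)
    then show ?thesis
      unfolding fps_sum_nth coeff_sum
      by (intro sum.cong) (auto simp: mult_ac coeff_monom_mult of_nat_poly simp flip: fps_of_nat)
  qed
  also have "\<dots> = (-1) ^ k * of_nat (N choose k) * (f ^ k * h ^ N) $ n"
    \<comment> \<open>For k > N no summand has j = k, and the binomial coefficient is 0 as
      well.\<close>
    by (auto simp: binomial_eq_0)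
  finally show ?thesis .
qed

theorem lemma7:
  fixes g f :: "'a::field_char_0 fps" and n k :: nat
  assumes "fps_nth g 0 \<noteq> 0"
    and "fps_nth f 0 = 0" and "fps_nth f 1 \<noteq> 0"
  shows "array_inversion (riordan_array g f) n k =
    (-1) ^ k / of_nat (n + 1) * of_nat ((n + 1) choose k) * fps_nth (f ^ k * (1 / g) ^ (n + 1)) n"
proof -
  define G where "G = array_gf (riordan_array g f)"
  define P where "P = (1 - fps_const [:0, 1:] * fps_lift f) * fps_lift (1 / g)"
  let ?U = "fps_rev (fps_X * G)"
  have "G * (1 - fps_const [:0, 1:] * fps_lift f) = fps_lift g"
    using array_gf_riordan_array[OF assms(2)] by (simp add: G_def fps_lift_def)
  then have "P * G = fps_lift (g * (1 / g))"
    by (simp add: P_def fps_lift_mult mult_ac)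
  also have "g * (1 / g) = 1"
    using assms(1) by (simp add: fps_divide_unit inverse_mult_eq_1')
  finally have PG: "P * G = 1" by simp
  \<comment> \<open>The linear coefficient of x G is G(0), hence a unit of R[y].\<close>
  have "P $ 0 * G $ 0 = 1"
    using arg_cong[OF PG, of "\<lambda>h. h $ 0"] by simp
  then have "(fps_X * G) $ 1 dvd 1"
    by (metis One_nat_def diff_Suc_1 dvd_triv_right fps_X_mult_nth nat.distinct(1))
  then have "?U oo (fps_X * G) = fps_X"
    by (intro fps_rev_compose) simp_all
  from lagrange_inversion[OF PG this, of n]
  have "of_nat (n + 1) * coeff (?U $ (n + 1)) k = coeff (P ^ (n + 1) $ n) k"
    by (metis coeff_smult of_nat_mult_conv_smult)
  \<comment> \<open>The shift in \<open>array_inversion\<close> makes its row n the coefficient of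
    x^(n+1) in U.\<close>
  then show ?thesis
    using coeff_power_one_minus_y_mult[of f "1 / g" "n + 1" n k]
    by (simp add: array_inversion_def G_def P_def field_simps del: of_nat_Suc)
qed

end
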